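(* The rational degenerate Sklyanin algebra $\mathfrak{sK}_r$ is isomorphic, as a unital associative algebra, to the algebra $\mathfrak{stab}^{*}$.
   Context: $[A,B]=AB-BA$, $\{A,B\}=AB+BA$; algebras are over $\mathbb{C}$. $\mathfrak{sK}_r$ is the unital associative algebra generated by $S_0,S_3,S_+,S_-$ with defining relations $$[S_0,S_-]=-2\{S_-,S_-\},\qquad [S_0,S_+]=16\{S_3,S_-\}-16\{S_-,S_-\}+2\{S_+,S_-\}-4\{S_3,S_3\},$$ $$[S_+,S_-]=2\{S_0,S_3\},\qquad [S_0,S_3]=2\{S_3,S_-\}-8\{S_-,S_-\},\qquad [S_3,S_\pm]=\pm\{S_0,S_\pm\}.$$ $\mathfrak{stab}^{*}$ is the unital associative algebra generated by $U,V,Y,R$ with defining relations $$[V,Y]=-\{U,Y\},\quad [U,Y]=-\{Y,Y\},\quad [U,V]=\{V,Y\}-2\{Y,Y\},$$ $$[R,Y]=\{U,U\}-\{U,V\}+\{V,Y\},\quad [R,V]=2\{V,Y\}-\{Y,Y\}-\{V,V\}-\{U,R\},$$ $$[R,U]=\{U,V\}+2\{V,Y\}-2\{U,Y\}-\{V,V\}-\{Y,Y\}-\{R,Y\}.$$ *)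

theory Defs
  imports Complex_Main "HOL-Library.Poly_Mapping" "HOL-Algebra.QuotRing" "HOL-Algebra.Module"
begin

section \<open>Unital associative algebras over the complex numbers\<close>

text \<open>The locale \<^locale>\<open>algebra\<close> of HOL-Algebra requires commutativity, so only its record type is
  reused here.\<close>

locale complex_algebra = ring A for A :: "(complex, 'a) module" (structure) +
  assumes smult_closed: "x \<in> carrier A \<Longrightarrow> c \<odot> x \<in> carrier A"
    and smult_l_distr: "x \<in> carrier A \<Longrightarrow> (c + d) \<odot> x = c \<odot> x \<oplus> d \<odot> x"
    and smult_r_distr: "\<lbrakk>x \<in> carrier A; y \<in> carrier A\<rbrakk> \<Longrightarrow> c \<odot> (x \<oplus> y) = c \<odot> x \<oplus> c \<odot> y"
    and smult_assoc: "x \<in> carrier A \<Longrightarrow> (c * d) \<odot> x = c \<odot> (d \<odot> x)"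
    and smult_one: "x \<in> carrier A \<Longrightarrow> 1 \<odot> x = x"
    and smult_mult_left: "\<lbrakk>x \<in> carrier A; y \<in> carrier A\<rbrakk> \<Longrightarrow> (c \<odot> x) \<otimes> y = c \<odot> (x \<otimes> y)"
    and smult_mult_right: "\<lbrakk>x \<in> carrier A; y \<in> carrier A\<rbrakk> \<Longrightarrow> x \<otimes> (c \<odot> y) = c \<odot> (x \<otimes> y)"

definition complex_algebra_iso ::
  "(complex, 'a) module \<Rightarrow> (complex, 'b) module \<Rightarrow> ('a \<Rightarrow> 'b) set" where
  "complex_algebra_iso A B =
     {h \<in> ring_iso A B. \<forall>c. \<forall>x \<in> carrier A. h (c \<odot>\<^bsub>A\<^esub> x) = c \<odot>\<^bsub>B\<^esub> h x}"

definition complex_algebra_isomorphic ::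
  "(complex, 'a) module \<Rightarrow> (complex, 'b) module \<Rightarrow> bool" where
  "complex_algebra_isomorphic A B \<longleftrightarrow> complex_algebra_iso A B \<noteq> {}"


section \<open>Free algebras\<close>

text \<open>Lists under concatenation, wrapped in a type of their own because the convolution product on
  \<^type>\<open>poly_mapping\<close> needs an (additively written) monoid of exponents.\<close>

datatype 'g free_word = Word (letters: "'g list")

instantiation free_word :: (type) monoid_add
begin

definition "0 = Word []"

definition "v + w = Word (letters v @ letters w)"

instance
  by standard (simp_all add: zero_free_word_def plus_free_word_def)

end

type_synonym 'g nc_poly = "'g free_word \<Rightarrow>\<^sub>0 complex"

definition gen :: "'g \<Rightarrow> 'g nc_poly" where
  "gen g = Poly_Mapping.single (Word [g]) 1"

definition scal :: "complex \<Rightarrow> 'g nc_poly" where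
  "scal c = Poly_Mapping.single 0 c"

definition free_algebra :: "(complex, 'g nc_poly) module" where
  "free_algebra = \<lparr>carrier = UNIV, mult = (*), one = 1, zero = 0, add = (+),
     smult = (\<lambda>c p. scal c * p)\<rparr>"


section \<open>Algebras given by generators and relations\<close>

text \<open>A relation is a pair consisting of its left-hand and its right-hand side.\<close>

definition relation_ideal :: "('g nc_poly \<times> 'g nc_poly) set \<Rightarrow> 'g nc_poly set" where
  "relation_ideal Rel = Idl\<^bsub>free_algebra\<^esub> {l - r | l r. (l, r) \<in> Rel}"

definition presented_algebra ::
  "('g nc_poly \<times> 'g nc_poly) set \<Rightarrow> (complex, 'g nc_poly set) module" where
  "presented_algebra Rel =
     (let F = free_algebra; I = relation_ideal Rel
      in ring.extend (F Quot I)
           (module.fields (\<lambda>c X. \<Union>x\<in>X. I +>\<^bsub>F\<^esub> (c \<odot>\<^bsub>F\<^esub> x))))"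

lemma free_algebra_simps [simp]:
  "carrier free_algebra = UNIV"
  "mult free_algebra = (*)"
  "one free_algebra = 1"
  "zero free_algebra = 0"
  "add free_algebra = (+)"
  "smult free_algebra c p = scal c * p"
  by (simp_all add: free_algebra_def)

lemma scal_add: "scal (c + d) = scal c + scal d"
  and scal_mult: "scal (c * d) = scal c * scal d"
  and scal_one: "scal 1 = 1"
  by (simp_all add: scal_def single_add mult_single)

lemma nc_poly_times_eq:
  fixes p q :: "'g nc_poly"
  shows "p * q = (\<Sum>v\<in>Poly_Mapping.keys p. \<Sum>w\<in>Poly_Mapping.keys q.
           Poly_Mapping.single (v + w) (Poly_Mapping.lookup p v * Poly_Mapping.lookup q w))"
proof -
  have dec: "r = (\<Sum>v\<in>Poly_Mapping.keys r. Poly_Mapping.single v (Poly_Mapping.lookup r v))"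
    for r :: "'g nc_poly"
    by (rule poly_mapping_eqI)
      (simp add: lookup_sum lookup_single when_def sum.delta in_keys_iff)
  have "p * q = (\<Sum>v\<in>Poly_Mapping.keys p. Poly_Mapping.single v (Poly_Mapping.lookup p v)) *
                (\<Sum>w\<in>Poly_Mapping.keys q. Poly_Mapping.single w (Poly_Mapping.lookup q w))"
    by (rule arg_cong2[where f = "(*)"]) (rule dec)+
  then show ?thesis
    by (simp add: sum_product mult_single)
qed

lemma scal_commute: "p * scal c = scal c * p"
  unfolding nc_poly_times_eq[of p] nc_poly_times_eq[of "scal c"]
  by (simp add: scal_def mult.commute)

lemma ring_free_algebra: "ring (free_algebra :: (complex, 'g nc_poly) module)"
proof (intro ringI abelian_groupI monoidI)
  fix x :: "'g nc_poly"
  show "\<exists>y\<in>carrier free_algebra. y \<oplus>\<^bsub>free_algebra\<^esub> x = \<zero>\<^bsub>free_algebra\<^esub>"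
    by (rule bexI[of _ "- x"]) simp_all
qed (simp_all add: algebra_simps)

lemma complex_algebra_free_algebra:
  "complex_algebra (free_algebra :: (complex, 'g nc_poly) module)"
proof (intro complex_algebra.intro complex_algebra_axioms.intro)
  fix x y :: "'g nc_poly" and c
  have "x * (scal c * y) = (x * scal c) * y"
    by (simp add: mult.assoc)
  also have "\<dots> = scal c * (x * y)"
    by (simp add: scal_commute mult.assoc)
  finally show "x \<otimes>\<^bsub>free_algebra\<^esub> (c \<odot>\<^bsub>free_algebra\<^esub> y) = c \<odot>\<^bsub>free_algebra\<^esub> (x \<otimes>\<^bsub>free_algebra\<^esub> y)"
    by simp
qed (simp_all add: ring_free_algebra scal_add scal_mult scal_one algebra_simps)

lemma ideal_relation_ideal: "ideal (relation_ideal Rel) free_algebra"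
  unfolding relation_ideal_def
  by (rule ring.genideal_ideal[OF ring_free_algebra]) simp

lemma presented_algebra_simps:
  fixes Rel :: "('g nc_poly \<times> 'g nc_poly) set"
  defines "Q \<equiv> free_algebra Quot relation_ideal Rel"
  shows "carrier (presented_algebra Rel) = carrier Q"
    "mult (presented_algebra Rel) = mult Q"
    "one (presented_algebra Rel) = one Q"
    "zero (presented_algebra Rel) = zero Q"
    "add (presented_algebra Rel) = add Q"
    "smult (presented_algebra Rel) c X =
       (\<Union>x\<in>X. relation_ideal Rel +>\<^bsub>free_algebra\<^esub> (c \<odot>\<^bsub>free_algebra\<^esub> x))"
  by (simp_all add: presented_algebra_def Q_def Let_def ring.defs module.defs)

lemma presented_algebra_cosets:
  fixes Rel :: "('g nc_poly \<times> 'g nc_poly) set"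
  defines "A \<equiv> presented_algebra Rel"
    and "cl \<equiv> \<lambda>x. relation_ideal Rel +>\<^bsub>free_algebra\<^esub> x"
  shows "carrier A = range cl"
    and "cl x \<oplus>\<^bsub>A\<^esub> cl y = cl (x + y)"
    and "cl x \<otimes>\<^bsub>A\<^esub> cl y = cl (x * y)"
    and "\<one>\<^bsub>A\<^esub> = cl 1"
    and "\<zero>\<^bsub>A\<^esub> = cl 0"
    and "c \<odot>\<^bsub>A\<^esub> cl x = cl (scal c * x)"
    and "cl x = cl y \<longleftrightarrow> x - y \<in> relation_ideal Rel"
proof -
  note I = ideal_relation_ideal[of Rel]
  note add_I = ideal.axioms(1)[OF I]
  have mem: "z \<in> cl x \<longleftrightarrow> z - x \<in> relation_ideal Rel" for z x
  proof -
    have "z \<in> cl x \<longleftrightarrow> (\<exists>h\<in>relation_ideal Rel. z = h + x)"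
      by (simp add: cl_def a_r_coset_def')
    also have "\<dots> \<longleftrightarrow> z - x \<in> relation_ideal Rel"
      by (metis add_diff_cancel_right' diff_add_cancel)
    finally show ?thesis .
  qed
  have add: "a + b \<in> relation_ideal Rel" if "a \<in> relation_ideal Rel" "b \<in> relation_ideal Rel" for a b
    using additive_subgroup.a_closed[OF add_I, of a b] that by simp
  have mult: "a * b \<in> relation_ideal Rel" if "b \<in> relation_ideal Rel" for a b
    using ideal.I_l_closed[OF I, of b a] that by simp
  have zero: "0 \<in> relation_ideal Rel"
    using additive_subgroup.zero_closed[OF add_I] by simp
  have neg: "- a \<in> relation_ideal Rel" if "a \<in> relation_ideal Rel" for a
    using mult[of a "- 1"] that by simp
  show eq: "cl x = cl y \<longleftrightarrow> x - y \<in> relation_ideal Rel" for x y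
  proof
    assume "cl x = cl y"
    moreover have "x \<in> cl x"
      by (simp add: mem zero)
    ultimately show "x - y \<in> relation_ideal Rel"
      using mem by blast
  next
    assume xy: "x - y \<in> relation_ideal Rel"
    show "cl x = cl y"
    proof (rule Set.set_eqI)
      fix z
      show "z \<in> cl x \<longleftrightarrow> z \<in> cl y"
        using add[of "z - x" "x - y"] add[of "z - y" "- (x - y)"] neg[OF xy] xy
        by (auto simp: mem)
    qed
  qed
  show "carrier A = range cl"
    by (auto simp: A_def cl_def presented_algebra_simps FactRing_def A_RCOSETS_def' image_def)
  show "cl x \<oplus>\<^bsub>A\<^esub> cl y = cl (x + y)"
    using ideal.a_rcos_sum[OF I, of x y] by (simp add: A_def cl_def presented_algebra_simps FactRing_def)
  show "cl x \<otimes>\<^bsub>A\<^esub> cl y = cl (x * y)"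
    using ideal.rcoset_mult_add[OF I, of x y] by (simp add: A_def cl_def presented_algebra_simps FactRing_def)
  show "\<one>\<^bsub>A\<^esub> = cl 1"
    by (simp add: A_def cl_def presented_algebra_simps FactRing_def)
  have "cl 0 = relation_ideal Rel"
    using mem[of _ 0] by auto
  then show "\<zero>\<^bsub>A\<^esub> = cl 0"
    by (simp add: A_def presented_algebra_simps FactRing_def)
  have const: "cl (scal c * z) = cl (scal c * x)" if "z \<in> cl x" for z
    using mult[of "z - x" "scal c"] that by (simp add: eq mem algebra_simps)
  have "cl x \<noteq> {}"
    using mem[of x x] zero by auto
  have "c \<odot>\<^bsub>A\<^esub> cl x = (\<Union>z\<in>cl x. cl (scal c * z))"
    by (simp add: A_def cl_def presented_algebra_simps)
  also have "\<dots> = (\<Union>z\<in>cl x. cl (scal c * x))"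
    by (rule SUP_cong[OF refl const])
  also have "\<dots> = cl (scal c * x)"
    using \<open>cl x \<noteq> {}\<close> by (rule cSUP_const)
  finally show "c \<odot>\<^bsub>A\<^esub> cl x = cl (scal c * x)" .
qed

lemma complex_algebra_presented_algebra: "complex_algebra (presented_algebra Rel)"
proof -
  note cl = presented_algebra_cosets(1-6)[of Rel]
  have "\<exists>Y\<in>carrier (presented_algebra Rel).
          Y \<oplus>\<^bsub>presented_algebra Rel\<^esub> X = \<zero>\<^bsub>presented_algebra Rel\<^esub>"
    if "X \<in> carrier (presented_algebra Rel)" for X
  proof -
    from that obtain x where "X = relation_ideal Rel +>\<^bsub>free_algebra\<^esub> x"
      unfolding cl by blast
    then show ?thesis
      by (intro bexI[of _ "relation_ideal Rel +>\<^bsub>free_algebra\<^esub> (- x)"]) (simp_all add: cl)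
  qed
  then have "ring (presented_algebra Rel)"
    by (intro ringI abelian_groupI monoidI) (auto simp: cl algebra_simps)
  moreover have "x * (scal c * y) = scal c * (x * y)" for x y :: "'a nc_poly" and c
    by (metis mult.assoc scal_commute)
  then have "X \<otimes>\<^bsub>presented_algebra Rel\<^esub> (c \<odot>\<^bsub>presented_algebra Rel\<^esub> Y) =
      c \<odot>\<^bsub>presented_algebra Rel\<^esub> (X \<otimes>\<^bsub>presented_algebra Rel\<^esub> Y)"
    if "X \<in> carrier (presented_algebra Rel)" "Y \<in> carrier (presented_algebra Rel)" for X Y c
    using that unfolding cl(1) by (clarsimp simp only: cl)
  ultimately show ?thesis
    by (intro complex_algebra.intro complex_algebra_axioms.intro)
      (auto simp: cl scal_add scal_mult scal_one ring_distribs mult.assoc)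
qed

lemma presented_algebra_relation:
  assumes "(l, r) \<in> Rel"
  shows "relation_ideal Rel +>\<^bsub>free_algebra\<^esub> l = relation_ideal Rel +>\<^bsub>free_algebra\<^esub> r"
proof -
  have "l - r \<in> relation_ideal Rel"
    using assms by (force simp: relation_ideal_def genideal_def)
  then show ?thesis
    by (subst presented_algebra_cosets(7))
qed


section \<open>The two algebras\<close>

definition comm :: "'a::ring_1 \<Rightarrow> 'a \<Rightarrow> 'a" where
  "comm a b = a * b - b * a"

definition acomm :: "'a::ring_1 \<Rightarrow> 'a \<Rightarrow> 'a" where
  "acomm a b = a * b + b * a"

datatype sK_gen = G_S0 | G_S3 | G_Sp | G_Sm

definition sK_relations :: "(sK_gen nc_poly \<times> sK_gen nc_poly) set" where
  "sK_relations =
     (let S0 = gen G_S0; S3 = gen G_S3; Sp = gen G_Sp; Sm = gen G_Sm in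
      {(comm S0 Sm, - 2 * acomm Sm Sm),
       (comm S0 Sp, 16 * acomm S3 Sm - 16 * acomm Sm Sm + 2 * acomm Sp Sm - 4 * acomm S3 S3),
       (comm Sp Sm, 2 * acomm S0 S3),
       (comm S0 S3, 2 * acomm S3 Sm - 8 * acomm Sm Sm),
       (comm S3 Sp, acomm S0 Sp),
       (comm S3 Sm, - acomm S0 Sm)})"

definition sK_r :: "(complex, sK_gen nc_poly set) module" where
  "sK_r = presented_algebra sK_relations"

datatype stab_gen = G_U | G_V | G_Y | G_R

definition stab_relations :: "(stab_gen nc_poly \<times> stab_gen nc_poly) set" where
  "stab_relations =
     (let U = gen G_U; V = gen G_V; Y = gen G_Y; R = gen G_R in
      {(comm V Y, - acomm U Y),
       (comm U Y, - acomm Y Y),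
       (comm U V, acomm V Y - 2 * acomm Y Y),
       (comm R Y, acomm U U - acomm U V + acomm V Y),
       (comm R V, 2 * acomm V Y - acomm Y Y - acomm V V - acomm U R),
       (comm R U, acomm U V + 2 * acomm V Y - 2 * acomm U Y - acomm V V - acomm Y Y - acomm R Y)})"

definition stab_star :: "(complex, stab_gen nc_poly set) module" where
  "stab_star = presented_algebra stab_relations"

end

theory Submission
  imports Defs
begin

text \<open>The linear substitution
  \<open>S\<^sub>0 = 2U - 2Y\<close>, \<open>S\<^sub>3 = 2V - 2U + Y\<close>, \<open>S\<^sub>- = Y\<close>, \<open>S\<^sub>+ = -8R + 4U - 12V + 7Y\<close>
  is invertible and carries the span of the defining relations of one algebra onto that of the
  other. It is found by a triangular ansatz: the relations for \<open>[S\<^sub>0, S\<^sub>-]\<close> and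
  \<open>[U, Y]\<close> suggest \<open>S\<^sub>-\<close> proportional to \<open>Y\<close>, and then \<open>S\<^sub>0\<close>, \<open>S\<^sub>3\<close>, \<open>S\<^sub>+\<close> are determined up to an
  overall scaling.\<close>

section \<open>Substitution homomorphisms\<close>

text \<open>The algebra homomorphism out of the free algebra sending each generator \<open>x\<close>
  to \<open>f x\<close>, written out on the basis of words.\<close>

definition subst :: "('g \<Rightarrow> 'h nc_poly) \<Rightarrow> 'g nc_poly \<Rightarrow> 'h nc_poly" where
  "subst f p = (\<Sum>w\<in>Poly_Mapping.keys p.
     scal (Poly_Mapping.lookup p w) * prod_list (map f (letters w)))"

lemma scal_0 [simp]: "scal 0 = 0"
  by (simp add: scal_def)

text \<open>Cancellation can make the support of \<open>p + q\<close> smaller than the union of the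
  supports, so additivity needs sums over a common larger index set.\<close>

lemma subst_superset:
  assumes "finite A" "Poly_Mapping.keys p \<subseteq> A"
  shows "subst f p = (\<Sum>w\<in>A. scal (Poly_Mapping.lookup p w) * prod_list (map f (letters w)))"
  unfolding subst_def using assms by (intro sum.mono_neutral_left) (auto simp: in_keys_iff)

lemma subst_zero [simp]: "subst f 0 = 0"
  by (simp add: subst_def)

lemma subst_single:
  "subst f (Poly_Mapping.single w c) = scal c * prod_list (map f (letters w))"
  by (subst subst_superset[of "{w}"]) auto

lemma subst_add [simp]: "subst f (p + q) = subst f p + subst f q"
proof -
  let ?A = "Poly_Mapping.keys p \<union> Poly_Mapping.keys q"
  have "Poly_Mapping.keys (p + q) \<subseteq> ?A"
    by (rule keys_add)
  then show ?thesis
    by (simp add: subst_superset[of ?A] lookup_add scal_add distrib_right sum.distrib)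
qed

lemma subst_minus [simp]: "subst f (- p) = - subst f p"
  using subst_add[of f p "- p"] by (simp add: eq_neg_iff_add_eq_0 add.commute)

lemma subst_diff [simp]: "subst f (p - q) = subst f p - subst f q"
  using subst_add[of f p "- q"] by simp

lemma subst_sum: "subst f (\<Sum>i\<in>A. p i) = (\<Sum>i\<in>A. subst f (p i))"
  by (induction A rule: infinite_finite_induct) simp_all

lemma scal_left_commute: "p * (scal c * q) = scal c * (p * q)"
  by (metis mult.assoc scal_commute)

text \<open>Concatenated words go to products of their images, and coefficients can be moved to the
  front because scalars are central.\<close>

lemma subst_mult [simp]: "subst f (p * q) = subst f p * subst f q"
  unfolding nc_poly_times_eq[of p q] subst_sum subst_single subst_def[of f p] subst_def[of f q]
    sum_product
  by (intro sum.cong refl)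
    (simp add: plus_free_word_def scal_mult mult.assoc
      scal_left_commute[of "prod_list _", symmetric])

lemma subst_scal [simp]: "subst f (scal c) = scal c"
  unfolding scal_def[of c] subst_single by (simp add: zero_free_word_def flip: scal_def)

lemma subst_one [simp]: "subst f 1 = 1"
  using subst_scal[of f 1] by (simp add: scal_one)

lemma subst_gen [simp]: "subst f (gen x) = f x"
  by (simp add: gen_def subst_single scal_one)

lemma subst_comm [simp]: "subst f (comm p q) = comm (subst f p) (subst f q)"
  and subst_acomm [simp]: "subst f (acomm p q) = acomm (subst f p) (subst f q)"
  by (simp_all add: comm_def acomm_def)

text \<open>Turns the integer coefficients of the relations into scalars, so that
  \<open>lookup_scal_mult\<close> applies to them. The numeral on the right is complex, so rewriting
  terminates.\<close>

lemma scal_numeral: "numeral n = scal (numeral n)"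
proof -
  have "scal (of_nat k) = of_nat k" for k
    by (induction k) (simp_all add: scal_add scal_one)
  from this[of "numeral n"] show ?thesis
    by simp
qed

lemma subst_numeral [simp]: "subst f (numeral n) = numeral n"
  unfolding scal_numeral by (rule subst_scal)

lemma prod_list_map_gen: "prod_list (map gen xs) = Poly_Mapping.single (Word xs) 1"
  by (induction xs)
    (simp_all add: gen_def mult_single plus_free_word_def flip: zero_free_word_def single_one)

lemma subst_gen_id: "subst gen p = p"
proof -
  have "subst gen p =
      (\<Sum>w\<in>Poly_Mapping.keys p. Poly_Mapping.single w (Poly_Mapping.lookup p w))"
    by (simp add: subst_def prod_list_map_gen scal_def mult_single)
  also have "\<dots> = p"
    by (rule poly_mapping_eqI) (simp add: lookup_sum lookup_single when_def in_keys_iff)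
  finally show ?thesis .
qed

lemma subst_prod_list: "subst g (prod_list ps) = prod_list (map (subst g) ps)"
  by (induction ps) simp_all

text \<open>Together with \<open>subst_gen_id\<close>, this reduces mutual inverseness of two
  substitutions to a check on generators.\<close>

lemma subst_subst: "subst g (subst f p) = subst (\<lambda>x. subst g (f x)) p"
  by (simp add: subst_def[of f] subst_def[of "\<lambda>x. subst g (f x)"] subst_sum subst_prod_list o_def)

lemma lookup_scal_mult: "Poly_Mapping.lookup (scal c * p) w = c * Poly_Mapping.lookup p w"
proof -
  have "scal c * p = (\<Sum>v\<in>Poly_Mapping.keys p. Poly_Mapping.single v (c * Poly_Mapping.lookup p v))"
    by (subst nc_poly_times_eq) (simp add: scal_def)
  then show ?thesis
    by (simp add: lookup_sum lookup_single when_def in_keys_iff)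
qed

section \<open>Isomorphisms of presented algebras\<close>

lemma relation_ideal_add:
    "a \<in> relation_ideal Rel \<Longrightarrow> b \<in> relation_ideal Rel \<Longrightarrow> a + b \<in> relation_ideal Rel"
  and relation_ideal_mult_left: "a \<in> relation_ideal Rel \<Longrightarrow> p * a \<in> relation_ideal Rel"
  using additive_subgroup.a_closed[OF ideal.axioms(1)[OF ideal_relation_ideal[of Rel]]]
    ideal.I_l_closed[OF ideal_relation_ideal[of Rel]]
  by simp_all

lemma relation_idealI: "(l, r) \<in> Rel \<Longrightarrow> l - r \<in> relation_ideal Rel"
  by (simp add: presented_algebra_relation flip: presented_algebra_cosets(7))

lemma ring_presented_algebra: "ring (presented_algebra Rel)"
  using complex_algebra_presented_algebra by (rule complex_algebra.axioms)

text \<open>The elements sent into \<open>relation_ideal Rel'\<close> form the kernel of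
  \<open>subst f\<close> followed by the quotient map. This kernel is an ideal containing the
  differences that generate \<open>relation_ideal Rel\<close>, so minimality applies.\<close>

lemma subst_relation_ideal:
  assumes "\<And>l r. (l, r) \<in> Rel \<Longrightarrow> subst f l - subst f r \<in> relation_ideal Rel'"
    and "p \<in> relation_ideal Rel"
  shows "subst f p \<in> relation_ideal Rel'"
proof -
  let ?cl = "\<lambda>x. relation_ideal Rel' +>\<^bsub>free_algebra\<^esub> x"
  let ?h = "\<lambda>p. ?cl (subst f p)"
  have "?h \<in> ring_hom free_algebra (presented_algebra Rel')"
    by (rule ring_hom_memI) (simp_all add: presented_algebra_cosets rangeI)
  then have "ring_hom_ring free_algebra (presented_algebra Rel') ?h"
    by (intro ring_hom_ringI2 ring_free_algebra ring_presented_algebra)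
  then have "ideal (a_kernel free_algebra (presented_algebra Rel') ?h) free_algebra"
    by (rule ring_hom_ring.kernel_is_ideal)
  moreover have kernel: "a_kernel free_algebra (presented_algebra Rel') ?h
      = {p. subst f p \<in> relation_ideal Rel'}"
    by (simp add: a_kernel_def' presented_algebra_cosets)
  ultimately have "relation_ideal Rel \<subseteq> {p. subst f p \<in> relation_ideal Rel'}"
    unfolding relation_ideal_def[of Rel]
    using assms(1) by (intro ring.genideal_minimal[OF ring_free_algebra]) auto
  with assms(2) show ?thesis by blast
qed

lemma presented_algebra_isomorphicI:
  assumes f: "\<And>l r. (l, r) \<in> Rel \<Longrightarrow> subst f l - subst f r \<in> relation_ideal Rel'"
    and g: "\<And>l r. (l, r) \<in> Rel' \<Longrightarrow> subst g l - subst g r \<in> relation_ideal Rel"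
    and gf: "\<And>x. subst g (f x) = gen x"
    and fg: "\<And>y. subst f (g y) = gen y"
  shows "complex_algebra_isomorphic (presented_algebra Rel) (presented_algebra Rel')"
proof -
  let ?cl = "\<lambda>x. relation_ideal Rel +>\<^bsub>free_algebra\<^esub> x"
  let ?cl' = "\<lambda>x. relation_ideal Rel' +>\<^bsub>free_algebra\<^esub> x"
  \<comment> \<open>The value on a coset uses a chosen representative; the fact \<open>h\<close>
    below shows independence of the choice, by \<open>subst_relation_ideal\<close>.\<close>
  define h where "h X = ?cl' (subst f (SOME x. X = ?cl x))" for X
  have gf': "subst g (subst f p) = p" for p
    by (simp add: subst_subst gf subst_gen_id)
  have fg': "subst f (subst g p) = p" for p
    by (simp add: subst_subst fg subst_gen_id)
  have h: "h (?cl x) = ?cl' (subst f x)" for x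
  proof -
    have "?cl x = ?cl (SOME y. ?cl x = ?cl y)"
      by (rule someI) (rule refl)
    then have "subst f (x - (SOME y. ?cl x = ?cl y)) \<in> relation_ideal Rel'"
      by (intro subst_relation_ideal[OF f]) (simp_all only: presented_algebra_cosets(7))
    then have "?cl' (subst f x) = ?cl' (subst f (SOME y. ?cl x = ?cl y))"
      by (simp only: presented_algebra_cosets(7) subst_diff)
    then show ?thesis
      by (simp only: h_def)
  qed
  have "h \<in> ring_hom (presented_algebra Rel) (presented_algebra Rel')"
    by (rule ring_hom_memI) (auto simp: presented_algebra_cosets(1-5) h)
  moreover have "inj_on h (carrier (presented_algebra Rel))"
  proof (rule inj_onI, unfold presented_algebra_cosets(1), elim rangeE)
    fix X Y x y
    assume "h X = h Y" and X: "X = ?cl x" and Y: "Y = ?cl y"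
    then have *: "subst f (x - y) \<in> relation_ideal Rel'"
      by (simp only: h presented_algebra_cosets(7) subst_diff)
    \<comment> \<open>Injectivity: \<open>g\<close> carries the membership back, and
      \<open>subst g\<close> undoes \<open>subst f\<close>.\<close>
    have "subst g (subst f (x - y)) \<in> relation_ideal Rel"
      by (rule subst_relation_ideal[OF g]) (use * in \<open>simp_all only:\<close>)
    then show "X = Y"
      unfolding X Y by (simp only: presented_algebra_cosets(7) gf')
  qed
  moreover have "h ` carrier (presented_algebra Rel) = carrier (presented_algebra Rel')"
  proof -
    have "?cl' y \<in> range (\<lambda>x. ?cl' (subst f x))" for y
      by (rule range_eqI[of _ _ "subst g y"]) (simp only: fg')
    then show ?thesis
      by (auto simp: presented_algebra_cosets(1) image_image h)
  qed
  moreover have "\<forall>c. \<forall>X\<in>carrier (presented_algebra Rel).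
      h (c \<odot>\<^bsub>presented_algebra Rel\<^esub> X) = c \<odot>\<^bsub>presented_algebra Rel'\<^esub> h X"
    by (auto simp: presented_algebra_cosets(1,6) h)
  ultimately have "h \<in> complex_algebra_iso (presented_algebra Rel) (presented_algebra Rel')"
    by (simp add: complex_algebra_iso_def ring_iso_def bij_betw_def)
  then show ?thesis
    by (auto simp: complex_algebra_isomorphic_def)
qed

section \<open>The change of generators\<close>

fun sK_to_stab :: "sK_gen \<Rightarrow> stab_gen nc_poly" where
  "sK_to_stab G_S0 = scal 2 * gen G_U - scal 2 * gen G_Y"
| "sK_to_stab G_S3 = scal 2 * gen G_V - scal 2 * gen G_U + gen G_Y"
| "sK_to_stab G_Sp =
     scal (- 8) * gen G_R + scal 4 * gen G_U - scal 12 * gen G_V + scal 7 * gen G_Y"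
| "sK_to_stab G_Sm = gen G_Y"

text \<open>Obtained by solving the triangular system successively for \<open>Y\<close>,
  \<open>U\<close>, \<open>V\<close>, \<open>R\<close>. Fractions enter through \<open>scal\<close>,
  as noncommutative polynomials have no division.\<close>

fun stab_to_sK :: "stab_gen \<Rightarrow> sK_gen nc_poly" where
  "stab_to_sK G_U = scal (1 / 2) * gen G_S0 + gen G_Sm"
| "stab_to_sK G_V =
     scal (1 / 2) * gen G_S3 + scal (1 / 2) * gen G_S0 + scal (1 / 2) * gen G_Sm"
| "stab_to_sK G_Y = gen G_Sm"
| "stab_to_sK G_R = scal (- 1 / 8) * gen G_Sp - scal (1 / 2) * gen G_S0
     - scal (3 / 4) * gen G_S3 + scal (5 / 8) * gen G_Sm"

text \<open>After these rules both sides of an identity of noncommutative polynomials are linear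
  combinations of words with complex coefficients, and comparing coefficients makes it an identity
  between complex numbers, within reach of commutative simplification.\<close>

lemmas nc_expand = comm_def acomm_def scal_numeral distrib_left distrib_right
  left_diff_distrib right_diff_distrib mult.assoc scal_left_commute[of "gen _"]

lemmas nc_lookup = lookup_add lookup_minus lookup_uminus lookup_scal_mult

lemma stab_to_sK_inverse: "subst stab_to_sK (sK_to_stab x) = gen x"
  by (cases x; rule poly_mapping_eqI) (simp_all add: nc_expand nc_lookup field_simps)

lemma sK_to_stab_inverse: "subst sK_to_stab (stab_to_sK y) = gen y"
  by (cases y; rule poly_mapping_eqI) (simp_all add: nc_expand nc_lookup field_simps)

text \<open>All relations are homogeneous quadratic and the substitution is linear, so complex
  combinations of the six differences \<open>d1\<close> to \<open>d6\<close> suffice.\<close>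

lemma sK_to_stab_relations:
  assumes "(l, r) \<in> sK_relations"
  shows "subst sK_to_stab l - subst sK_to_stab r \<in> relation_ideal stab_relations"
proof -
  define U V Y R :: "stab_gen nc_poly"
    where gens: "U = gen G_U" "V = gen G_V" "Y = gen G_Y" "R = gen G_R"
  define d1 where "d1 = comm V Y - (- acomm U Y)"
  define d2 where "d2 = comm U Y - (- acomm Y Y)"
  define d3 where "d3 = comm U V - (acomm V Y - 2 * acomm Y Y)"
  define d4 where "d4 = comm R Y - (acomm U U - acomm U V + acomm V Y)"
  define d5 where "d5 = comm R V - (2 * acomm V Y - acomm Y Y - acomm V V - acomm U R)"
  define d6 where "d6 = comm R U -
    (acomm U V + 2 * acomm V Y - 2 * acomm U Y - acomm V V - acomm Y Y - acomm R Y)"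
  note d_defs = d1_def d2_def d3_def d4_def d5_def d6_def
  \<comment> \<open>Stating the hypothesis word by word leaves, for explicit coefficients, only a
    linear identity between complex numbers.\<close>
  have span: "p \<in> relation_ideal stab_relations"
    if "\<And>w. Poly_Mapping.lookup p w = a1 * Poly_Mapping.lookup d1 w + a2 * Poly_Mapping.lookup d2 w
      + a3 * Poly_Mapping.lookup d3 w + a4 * Poly_Mapping.lookup d4 w
      + a5 * Poly_Mapping.lookup d5 w + a6 * Poly_Mapping.lookup d6 w" for p a1 a2 a3 a4 a5 a6
  proof -
    have "p = scal a1 * d1 + scal a2 * d2 + scal a3 * d3 + scal a4 * d4 + scal a5 * d5 + scal a6 * d6"
      by (rule poly_mapping_eqI) (simp add: nc_lookup that)
    also have "\<dots> \<in> relation_ideal stab_relations"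
      unfolding d_defs
      by (intro relation_ideal_add relation_ideal_mult_left relation_idealI)
        (simp_all add: stab_relations_def gens Let_def)
    finally show ?thesis .
  qed
  note expand = gens d_defs nc_expand
  from assms consider
      "l = comm (gen G_S0) (gen G_Sm)" "r = - 2 * acomm (gen G_Sm) (gen G_Sm)"
    | "l = comm (gen G_S0) (gen G_Sp)"
      "r = 16 * acomm (gen G_S3) (gen G_Sm) - 16 * acomm (gen G_Sm) (gen G_Sm)
         + 2 * acomm (gen G_Sp) (gen G_Sm) - 4 * acomm (gen G_S3) (gen G_S3)"
    | "l = comm (gen G_Sp) (gen G_Sm)" "r = 2 * acomm (gen G_S0) (gen G_S3)"
    | "l = comm (gen G_S0) (gen G_S3)"
      "r = 2 * acomm (gen G_S3) (gen G_Sm) - 8 * acomm (gen G_Sm) (gen G_Sm)"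
    | "l = comm (gen G_S3) (gen G_Sp)" "r = acomm (gen G_S0) (gen G_Sp)"
    | "l = comm (gen G_S3) (gen G_Sm)" "r = - acomm (gen G_S0) (gen G_Sm)"
    unfolding sK_relations_def Let_def by blast
  then show ?thesis
  proof cases
    \<comment> \<open>In every case the coefficients are read off the commutator on the left. The
      commutators in \<open>d1\<close> to \<open>d6\<close> run over the six pairs of distinct
      generators and all other terms are symmetric, so the antisymmetric part fixes the
      coefficients; the simplifier then confirms the symmetric part.\<close>
    case 1
    show ?thesis
      by (rule span[of _ 0 2 0 0 0 0]) (simp add: 1 expand nc_lookup field_simps)
  next
    case 2
    show ?thesis
      by (rule span[of _ "- 24" 22 "- 24" "- 16" 0 16]) (simp add: 2 expand nc_lookup field_simps)
  next
    case 3
    show ?thesis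
      by (rule span[of _ "- 12" 4 0 "- 8" 0 0]) (simp add: 3 expand nc_lookup field_simps)
  next
    case 4
    show ?thesis
      by (rule span[of _ 4 "- 2" 4 0 0 0]) (simp add: 4 expand nc_lookup field_simps)
  next
    case 5
    show ?thesis
      by (rule span[of _ 26 "- 18" 16 8 16 "- 16"]) (simp add: 5 expand nc_lookup field_simps)
  next
    case 6
    show ?thesis
      by (rule span[of _ 2 "- 2" 0 0 0 0]) (simp add: 6 expand nc_lookup field_simps)
  qed
qed

lemma stab_to_sK_relations:
  assumes "(l, r) \<in> stab_relations"
  shows "subst stab_to_sK l - subst stab_to_sK r \<in> relation_ideal sK_relations"
proof -
  define S0 S3 Sp Sm :: "sK_gen nc_poly"
    where gens: "S0 = gen G_S0" "S3 = gen G_S3" "Sp = gen G_Sp" "Sm = gen G_Sm"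
  define d1 where "d1 = comm S0 Sm - (- 2 * acomm Sm Sm)"
  define d2 where "d2 = comm S0 Sp -
    (16 * acomm S3 Sm - 16 * acomm Sm Sm + 2 * acomm Sp Sm - 4 * acomm S3 S3)"
  define d3 where "d3 = comm Sp Sm - 2 * acomm S0 S3"
  define d4 where "d4 = comm S0 S3 - (2 * acomm S3 Sm - 8 * acomm Sm Sm)"
  define d5 where "d5 = comm S3 Sp - acomm S0 Sp"
  define d6 where "d6 = comm S3 Sm - (- acomm S0 Sm)"
  note d_defs = d1_def d2_def d3_def d4_def d5_def d6_def
  have span: "p \<in> relation_ideal sK_relations"
    if "\<And>w. Poly_Mapping.lookup p w = a1 * Poly_Mapping.lookup d1 w + a2 * Poly_Mapping.lookup d2 w
      + a3 * Poly_Mapping.lookup d3 w + a4 * Poly_Mapping.lookup d4 w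
      + a5 * Poly_Mapping.lookup d5 w + a6 * Poly_Mapping.lookup d6 w" for p a1 a2 a3 a4 a5 a6
  proof -
    have "p = scal a1 * d1 + scal a2 * d2 + scal a3 * d3 + scal a4 * d4 + scal a5 * d5 + scal a6 * d6"
      by (rule poly_mapping_eqI) (simp add: nc_lookup that)
    also have "\<dots> \<in> relation_ideal sK_relations"
      unfolding d_defs
      by (intro relation_ideal_add relation_ideal_mult_left relation_idealI)
        (simp_all add: sK_relations_def gens Let_def)
    finally show ?thesis .
  qed
  note expand = gens d_defs nc_expand
  from assms consider
      "l = comm (gen G_V) (gen G_Y)" "r = - acomm (gen G_U) (gen G_Y)"
    | "l = comm (gen G_U) (gen G_Y)" "r = - acomm (gen G_Y) (gen G_Y)"
    | "l = comm (gen G_U) (gen G_V)"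
      "r = acomm (gen G_V) (gen G_Y) - 2 * acomm (gen G_Y) (gen G_Y)"
    | "l = comm (gen G_R) (gen G_Y)"
      "r = acomm (gen G_U) (gen G_U) - acomm (gen G_U) (gen G_V) + acomm (gen G_V) (gen G_Y)"
    | "l = comm (gen G_R) (gen G_V)"
      "r = 2 * acomm (gen G_V) (gen G_Y) - acomm (gen G_Y) (gen G_Y)
         - acomm (gen G_V) (gen G_V) - acomm (gen G_U) (gen G_R)"
    | "l = comm (gen G_R) (gen G_U)"
      "r = acomm (gen G_U) (gen G_V) + 2 * acomm (gen G_V) (gen G_Y)
         - 2 * acomm (gen G_U) (gen G_Y) - acomm (gen G_V) (gen G_V)
         - acomm (gen G_Y) (gen G_Y) - acomm (gen G_R) (gen G_Y)"
    unfolding stab_relations_def Let_def by blast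
  then show ?thesis
  proof cases
    \<comment> \<open>Again the coefficients come from expanding the left-hand commutator in the six
      commutators of the generators \<open>S0\<close>, \<open>S3\<close>, \<open>Sp\<close>,
      \<open>Sm\<close>; the fractions are those of \<open>stab_to_sK\<close>.\<close>
    case 1
    show ?thesis
      by (rule span[of _ "1 / 2" 0 0 0 0 "1 / 2"]) (simp add: 1 expand nc_lookup field_simps)
  next
    case 2
    show ?thesis
      by (rule span[of _ "1 / 2" 0 0 0 0 0]) (simp add: 2 expand nc_lookup field_simps)
  next
    case 3
    show ?thesis
      by (rule span[of _ "- 1 / 4" 0 0 "1 / 4" 0 "- 1 / 2"]) (simp add: 3 expand nc_lookup field_simps)
  next
    case 4
    show ?thesis
      by (rule span[of _ "- 1 / 2" 0 "- 1 / 8" 0 0 "- 3 / 4"]) (simp add: 4 expand nc_lookup field_simps)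
  next
    case 5
    show ?thesis
      by (rule span[of _ "- 9 / 16" "1 / 16" "- 1 / 16" "1 / 8" "1 / 16" "- 11 / 16"]) (simp add: 5 expand nc_lookup field_simps)
  next
    case 6
    show ?thesis
      by (rule span[of _ "- 13 / 16" "1 / 16" "- 1 / 8" "3 / 8" 0 "- 3 / 4"]) (simp add: 6 expand nc_lookup field_simps)
  qed
qed

theorem proposition7:
  shows "complex_algebra_isomorphic sK_r stab_star"
  unfolding sK_r_def stab_star_def
  by (rule presented_algebra_isomorphicI[of _ sK_to_stab _ stab_to_sK])
    (simp_all only: sK_to_stab_relations stab_to_sK_relations
      stab_to_sK_inverse sK_to_stab_inverse)

end
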